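(* $L(3,n) = \Omega(n^2)$ as $n\to\infty$.
   Context: A coloring game is given by a finite set $V$ of $n$ players and a symmetric weight function $w$ with $w_{uv}=w_{vu}\in \mathbb{Z}\cup\{-\infty\}$ for distinct $u,v$. A state is a partition $P$ of $V$; $X(u)$ is the group of $u$ and $f_u(P)=\sum_{v\in X(u)\setminus\{u\}} w_{uv}$. A $k$-deviation from $P$ is a set $S$ of at most $k$ players and a (possibly empty) group $X$ of $P$ such that moving all players of $S$ into $X$ strictly increases the utility of every member of $S$. Starting from the all-singletons partition, $k$-deviations are applied successively. The game is uniform if all weights lie in $\{-\infty,1\}$. $L(k,n)$ is the maximum length of a sequence of successive $k$-deviations (from the all-singletons partition) over all uniform games with at most $n$ players. *)

theory Defs
  imports
    "HOL-Library.Extended_Real"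
    "HOL-Library.Disjoint_Sets"
    "HOL-Library.Landau_Symbols"
begin

(* Weights live in ereal; the diagonal and values outside V are irrelevant. *)
definition coloring_game :: "'a set \<Rightarrow> ('a \<Rightarrow> 'a \<Rightarrow> ereal) \<Rightarrow> bool" where
  "coloring_game V w \<longleftrightarrow> finite V \<and>
     (\<forall>u\<in>V. \<forall>v\<in>V. u \<noteq> v \<longrightarrow>
        w u v = w v u \<and> w u v \<in> insert (- \<infinity>) (range (\<lambda>z::int. ereal (of_int z))))"

definition uniform_game :: "'a set \<Rightarrow> ('a \<Rightarrow> 'a \<Rightarrow> ereal) \<Rightarrow> bool" where
  "uniform_game V w \<longleftrightarrow> coloring_game V w \<and>
     (\<forall>u\<in>V. \<forall>v\<in>V. u \<noteq> v \<longrightarrow> w u v \<in> {- \<infinity>, 1})"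

definition group_of :: "'a set set \<Rightarrow> 'a \<Rightarrow> 'a set" where
  "group_of P u = (THE X. X \<in> P \<and> u \<in> X)"

definition utility :: "('a \<Rightarrow> 'a \<Rightarrow> ereal) \<Rightarrow> 'a set set \<Rightarrow> 'a \<Rightarrow> ereal" where
  "utility w P u = (\<Sum>v\<in>group_of P u - {u}. w u v)"

definition singletons :: "'a set \<Rightarrow> 'a set set" where
  "singletons V = (\<lambda>u. {u}) ` V"

(* Groups emptied by the move are discarded, so that the result is again a partition;
   X = {} makes S a new group. *)
definition move :: "'a set set \<Rightarrow> 'a set \<Rightarrow> 'a set \<Rightarrow> 'a set set" where
  "move P S X = insert (X \<union> S) ((\<lambda>Y. Y - S) ` (P - {X})) - {{}}"

(* S must be nonempty: otherwise doing nothing would count as a deviation. S may meet X; the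
   members of S already in X stay where they are and must strictly gain as well. *)
definition is_deviation ::
  "'a set \<Rightarrow> ('a \<Rightarrow> 'a \<Rightarrow> ereal) \<Rightarrow> nat \<Rightarrow> 'a set set \<Rightarrow> 'a set \<Rightarrow> 'a set \<Rightarrow> bool" where
  "is_deviation V w k P S X \<longleftrightarrow>
     S \<subseteq> V \<and> S \<noteq> {} \<and> card S \<le> k \<and> (X \<in> P \<or> X = {}) \<and>
     (\<forall>u\<in>S. utility w P u < utility w (move P S X) u)"

definition deviates ::
  "'a set \<Rightarrow> ('a \<Rightarrow> 'a \<Rightarrow> ereal) \<Rightarrow> nat \<Rightarrow> 'a set set \<Rightarrow> 'a set set \<Rightarrow> bool" where
  "deviates V w k P P' \<longleftrightarrow>
     partition_on V P \<and> (\<exists>S X. is_deviation V w k P S X \<and> P' = move P S X)"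

definition deviation_length ::
  "'a set \<Rightarrow> ('a \<Rightarrow> 'a \<Rightarrow> ereal) \<Rightarrow> nat \<Rightarrow> nat \<Rightarrow> bool" where
  "deviation_length V w k m \<longleftrightarrow> (\<exists>P. (deviates V w k ^^ m) (singletons V) P)"

(* Games are taken up to renaming of the players, hence players of type nat.
   The set contains 0 (V = {}) and is bounded: in a state reachable from the singletons every
   utility is the size of the group minus 1, so each deviation strictly increases the sum of
   (n + 1) ^ card X over all groups X. Thus Max is a genuine maximum. *)
definition L :: "nat \<Rightarrow> nat \<Rightarrow> nat" where
  "L k n = Max {m. \<exists>(V :: nat set) w.
     uniform_game V w \<and> card V \<le> n \<and> deviation_length V w k m}"

end

theory Submission
  imports Defs "HOL-Library.Multiset" "HOL-Library.Discrete_Functions"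
begin

text \<open>When all weights are 1, only the multiset of group sizes matters, and joining a group pays
  exactly when the new group is larger than the old one. Moving one player from each of three groups
  of size \<open>p\<close> into a group of size \<open>p - 2\<close> turns the effect of \<open>(p - 1, p - 1) \<rightarrow> (p, p - 2)\<close> into that
  of \<open>(p, p) \<rightarrow> (p + 1, p - 1)\<close>, so a disturbance created by pairing two singletons travels upwards
  one size per deviation, as long as every size below is present at least twice. Disturbances sent
  to the sizes \<open>j, j - 1, \<dots>, 1\<close> in turn have the net effect that one singleton joins a group of
  size \<open>j\<close>, at the cost of order \<open>j\<^sup>2\<close> deviations. A group of size \<open>j\<close> thus takes order \<open>j\<^sup>3\<close>
  deviations, and building two groups of each size up to \<open>m\<close> takes order \<open>m\<^sup>4\<close> deviations with
  \<open>m (m + 1)\<close> players.\<close>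

section \<open>Long runs of steps on multisets of group sizes\<close>

text \<open>Entries 0 stand for empty groups, so that founding a new group is an instance of the rule.\<close>
inductive size_step :: "nat multiset \<Rightarrow> nat multiset \<Rightarrow> bool" where
  size_stepI: "r \<le> 3 \<Longrightarrow> 0 < r \<Longrightarrow> 0 < p \<Longrightarrow> p < q + r \<Longrightarrow>
    size_step (A + replicate_mset r p + {#q#}) (A + replicate_mset r (p - 1) + {#q + r#})"

text \<open>Induction on the height reached. The base step pairs two singletons, leaving an entry 0;
  every later step repairs the sizes below, so that only the top pair ends up changed.\<close>

lemma size_steps_travel:
  assumes "\<And>i. 1 \<le> i \<Longrightarrow> i \<le> Suc j \<Longrightarrow> 2 \<le> count A i"
  shows "(size_step ^^ Suc j) A (A - {#Suc j, Suc j#} + {#Suc (Suc j), j#})"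
  using assms
proof (induction j)
  case 0
  define B where "B = A - {#1, 1#}"
  have "{#1, 1#} \<subseteq># A"
    using 0[of 1] by (auto simp: subseteq_mset_def)
  then have "A = B + {#1, 1#}"
    unfolding B_def by (metis subset_mset.diff_add)
  then have A: "A = B + replicate_mset 1 1 + {#1#}"
    by simp
  have "size_step A (B + replicate_mset 1 (1 - 1) + {#1 + 1#})"
    unfolding A by (rule size_stepI) auto
  then show ?case
    by (simp add: B_def numeral_2_eq_2 add_mset_commute eq_OO)
next
  case (Suc j)
  define p where "p = Suc (Suc j)"
  define B where "B = A - {#p, p, Suc j, Suc j#}"
  have "{#p, p, Suc j, Suc j#} \<subseteq># A"
    using Suc.prems[of p] Suc.prems[of "Suc j"] by (auto simp: subseteq_mset_def p_def)
  then have A: "A = B + {#p, p, Suc j, Suc j#}"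
    unfolding B_def by (metis subset_mset.diff_add)
  have "(size_step ^^ Suc j) A (A - {#Suc j, Suc j#} + {#p, j#})"
    unfolding p_def by (rule Suc.IH) (use Suc.prems in auto)
  \<comment> \<open>Outside \<open>B\<close>, size \<open>p\<close> now occurs three times: the pair
    from \<open>A\<close> and the group just lifted. The remaining group \<open>j\<close> is
    \<open>p - 2\<close>, so three joining players bring it to \<open>Suc p\<close>.\<close>
  also have "A - {#Suc j, Suc j#} + {#p, j#} = B + replicate_mset 3 p + {#j#}"
    unfolding A by (simp add: numeral_3_eq_3 multiset_eq_iff)
  finally have 1: "(size_step ^^ Suc j) A (B + replicate_mset 3 p + {#j#})" .
  have "size_step (B + replicate_mset 3 p + {#j#}) (B + replicate_mset 3 (p - 1) + {#j + 3#})"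
    by (rule size_stepI) (auto simp: p_def)
  also have "B + replicate_mset 3 (p - 1) + {#j + 3#} = A - {#p, p#} + {#Suc p, Suc j#}"
    unfolding A by (simp add: numeral_3_eq_3 multiset_eq_iff p_def)
  finally show ?case
    using 1 unfolding p_def by (meson relpowp_Suc_I)
qed

text \<open>The changes from (\<open>i\<close>, \<open>i\<close>) to (\<open>i + 1\<close>,
  \<open>i - 1\<close>) for \<open>i\<close> from \<open>Suc j\<close> down to 1 cancel except at
  both ends, where a group of size \<open>Suc j\<close> grows and a singleton vanishes. Their
  lengths sum to a triangular number.\<close>

lemma size_steps_round:
  assumes "\<And>i. 1 \<le> i \<Longrightarrow> i \<le> Suc j \<Longrightarrow> 2 \<le> count A i"
  shows "(size_step ^^ (Suc (Suc j) choose 2)) A (A - {#Suc j, 1#} + {#Suc (Suc j), 0#})"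
  using assms
proof (induction j arbitrary: A)
  case 0
  then show ?case
    using size_steps_travel[of 0 A] by (simp add: numeral_2_eq_2)
next
  case (Suc j)
  define B where "B = A - {#Suc (Suc j), Suc (Suc j)#} + {#Suc (Suc (Suc j)), Suc j#}"
  have 1: "(size_step ^^ Suc (Suc j)) A B"
    unfolding B_def by (rule size_steps_travel) (use Suc.prems in auto)
  \<comment> \<open>The first disturbance removes copies of the top size only, so the pairs below it
    are intact for the remaining ones.\<close>
  have B: "2 \<le> count B i" if "1 \<le> i" "i \<le> Suc j" for i
    using Suc.prems[of i] that by (auto simp: B_def simp flip: count_greater_zero_iff)
  have "(size_step ^^ (Suc (Suc j) choose 2)) B (B - {#Suc j, 1#} + {#Suc (Suc j), 0#})"
    by (rule Suc.IH) (rule B)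
  also have "B - {#Suc j, 1#} + {#Suc (Suc j), 0#} =
      A - {#Suc (Suc j), 1#} + {#Suc (Suc (Suc j)), 0#}"
    using Suc.prems[of 1] Suc.prems[of "Suc (Suc j)"]
    by (auto simp: B_def multiset_eq_iff)
  finally have "(size_step ^^ (Suc (Suc j) + (Suc (Suc j) choose 2))) A
      (A - {#Suc (Suc j), 1#} + {#Suc (Suc (Suc j)), 0#})"
    using 1 unfolding relpowp_add by blast
  moreover have "Suc (Suc j) + (Suc (Suc j) choose 2) = Suc (Suc (Suc j)) choose 2"
    by (simp add: numeral_2_eq_2)
  ultimately show ?case
    by (simp only:)
qed

text \<open>The pairs in \<open>A\<close> act as catalysts and reappear unchanged. By induction all
  but one of the singletons form a group of the previous size, and a round lets the last one join
  it; the triangular costs sum to a tetrahedral number.\<close>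

lemma size_steps_build:
  assumes "\<And>i. 1 \<le> i \<Longrightarrow> i \<le> j \<Longrightarrow> 2 \<le> count A i"
  shows "(size_step ^^ (j + 2 choose 3)) (A + replicate_mset (Suc j) 1)
    (A + {#Suc j#} + replicate_mset j 0)"
  using assms
proof (induction j arbitrary: A)
  case 0
  then show ?case by (simp add: binomial_eq_0)
next
  case (Suc j)
  define B where "B = A + {#1#} + {#Suc j#} + replicate_mset j 0"
  have cnt: "2 \<le> count (A + E) i" if "1 \<le> i" "i \<le> Suc j" for i E
    using Suc.prems[OF that] by simp
  have 1: "(size_step ^^ (j + 2 choose 3)) (A + {#1#} + replicate_mset (Suc j) 1) B"
    unfolding B_def by (rule Suc.IH, rule cnt) auto
  have "(size_step ^^ (Suc (Suc j) choose 2)) B (B - {#Suc j, 1#} + {#Suc (Suc j), 0#})"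
    unfolding B_def add.assoc by (rule size_steps_round) (use cnt in blast)
  also have "B - {#Suc j, 1#} + {#Suc (Suc j), 0#} =
      A + {#Suc (Suc j)#} + replicate_mset (Suc j) 0"
    by (simp add: B_def multiset_eq_iff)
  finally have "(size_step ^^ ((j + 2 choose 3) + (Suc (Suc j) choose 2)))
      (A + {#1#} + replicate_mset (Suc j) 1) (A + {#Suc (Suc j)#} + replicate_mset (Suc j) 0)"
    using 1 unfolding relpowp_add by blast
  moreover have "(j + 2 choose 3) + (Suc (Suc j) choose 2) = Suc j + 2 choose 3"
    by (simp add: numeral_2_eq_2 numeral_3_eq_3)
  moreover have "A + {#1#} + replicate_mset (Suc j) 1 = A + replicate_mset (Suc (Suc j)) 1"
    by simp
  ultimately show ?case
    by (simp only:)
qed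

primrec staircase :: "nat \<Rightarrow> nat multiset" where
  "staircase 0 = {#}"
| "staircase (Suc m) = staircase m + {#Suc m, Suc m#}"

lemma count_staircase: "1 \<le> i \<Longrightarrow> i \<le> m \<Longrightarrow> 2 \<le> count (staircase m) i"
  by (induction m) (auto simp: le_Suc_eq simp flip: count_greater_zero_iff)

text \<open>The context \<open>C\<close> carries the singletons reserved for higher stairs through
  the induction. Each stair costs two builds, and the tetrahedral numbers sum by Pascal's
  rule.\<close>

lemma size_steps_staircase:
  "\<exists>z. (size_step ^^ (2 * (m + 2 choose 4))) (C + replicate_mset (m * Suc m) 1)
    (C + staircase m + replicate_mset z 0)"
proof (induction m arbitrary: C)
  case 0
  then show ?case by (auto simp: binomial_eq_0 intro: exI[of _ 0])
next
  case (Suc m)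
  let ?t = "m + 2 choose 3"
  let ?o = "replicate_mset (Suc m) (1 :: nat)"
  have cnt: "2 \<le> count (D + staircase m + E) i" if "1 \<le> i" "i \<le> m" for i D E
    using count_staircase[OF that] by simp
  \<comment> \<open>Both groups of size \<open>Suc m\<close> get their own supply of
    \<open>Suc m\<close> singletons, as
    \<open>(m + 1) * (m + 2) = m * (m + 1) + 2 * (m + 1)\<close>.\<close>
  have start: "C + ?o + ?o + replicate_mset (m * Suc m) 1 = C + replicate_mset (Suc m * Suc (Suc m)) 1"
    by (simp add: multiset_eq_iff)
  obtain z where 1: "(size_step ^^ (2 * (m + 2 choose 4))) (C + ?o + ?o + replicate_mset (m * Suc m) 1)
      (C + ?o + ?o + staircase m + replicate_mset z 0)"
    using Suc.IH by blast
  have eq1: "C + ?o + ?o + staircase m + replicate_mset z 0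
      = (C + ?o) + staircase m + replicate_mset z 0 + ?o"
    by (simp add: multiset_eq_iff)
  have 2: "(size_step ^^ ?t) ((C + ?o) + staircase m + replicate_mset z 0 + ?o)
      ((C + ?o) + staircase m + replicate_mset z 0 + {#Suc m#} + replicate_mset m 0)"
    by (rule size_steps_build) (use cnt in blast)
  have eq2: "(C + ?o) + staircase m + replicate_mset z 0 + {#Suc m#} + replicate_mset m 0
      = C + staircase m + (replicate_mset z 0 + {#Suc m#} + replicate_mset m 0) + ?o"
    by (simp add: multiset_eq_iff)
  have 3: "(size_step ^^ ?t)
      (C + staircase m + (replicate_mset z 0 + {#Suc m#} + replicate_mset m 0) + ?o)
      (C + staircase m + (replicate_mset z 0 + {#Suc m#} + replicate_mset m 0)
         + {#Suc m#} + replicate_mset m 0)"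
    by (rule size_steps_build) (use cnt in blast)
  have eq3: "C + staircase m + (replicate_mset z 0 + {#Suc m#} + replicate_mset m 0)
         + {#Suc m#} + replicate_mset m 0
      = C + staircase (Suc m) + replicate_mset (z + m + m) 0"
    by (simp add: multiset_eq_iff)
  have "(size_step ^^ (2 * (m + 2 choose 4) + ?t + ?t))
      (C + replicate_mset (Suc m * Suc (Suc m)) 1)
      (C + staircase (Suc m) + replicate_mset (z + m + m) 0)"
    using 1 2 3 unfolding relpowp_add eq1 eq2 eq3 start by blast
  moreover have "2 * (m + 2 choose 4) + ?t + ?t = 2 * (Suc m + 2 choose 4)"
  proof -
    have "Suc (m + 2) choose Suc 3 = (m + 2 choose 3) + (m + 2 choose Suc 3)"
      by (rule binomial_Suc_Suc)
    then show ?thesis by simp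
  qed
  ultimately show ?case by auto
qed

section \<open>Partitions, moves and utilities\<close>

lemma group_of_eq:
  assumes "partition_on V P" "Y \<in> P" "u \<in> Y"
  shows "group_of P u = Y"
  unfolding group_of_def
proof (rule the_equality)
  fix X
  assume "X \<in> P \<and> u \<in> X"
  then show "X = Y"
    using assms partition_onD2[OF assms(1)] by (auto simp: disjoint_def)
qed (use assms in auto)

lemma partition_on_move:
  assumes P: "partition_on V P" and "S \<subseteq> V" "X \<in> P \<or> X = {}"
  shows "partition_on V (move P S X)"
proof (rule partition_onI)
  have V: "V = \<Union>P"
    using P by (rule partition_onD1)
  then show "\<Union>(move P S X) = V"
    using assms(2,3) by (auto simp: move_def)
  have disj: "Y \<inter> Z = {}" if "Y \<in> P" "Z \<in> P" "Y \<noteq> Z" for Y Z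
    using partition_onD2[OF P] that by (auto simp: disjoint_def)
  let ?F = "(\<lambda>Y. Y - S) ` (P - {X})"
  have new: "disjnt (X \<union> S) Z" if "Z \<in> ?F" for Z
    using that disj assms(3) unfolding disjnt_def by blast
  have old: "disjnt Y Z" if "Y \<in> ?F" "Z \<in> ?F" "Y \<noteq> Z" for Y Z
    using that disj unfolding disjnt_def by blast
  fix Y Z
  assume "Y \<in> move P S X" "Z \<in> move P S X" "Y \<noteq> Z"
  then show "disjnt Y Z"
    using new old disjnt_sym unfolding move_def by (metis Diff_iff insert_iff)
qed (simp add: move_def)

lemma group_of_move:
  assumes "partition_on V P" "S \<subseteq> V" "X \<in> P \<or> X = {}" "u \<in> S"
  shows "group_of (move P S X) u = X \<union> S"
  by (rule group_of_eq[OF partition_on_move[OF assms(1-3)]]) (use assms(4) in \<open>auto simp: move_def\<close>)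

text \<open>Only the weights seen from \<open>u\<close> within its group are fixed, so this serves
  the all-ones game as well as groups of weight 1 in any uniform game.\<close>

lemma utility_clique:
  assumes "group_of P u = Y" "finite Y" "u \<in> Y" "\<And>v. v \<in> Y - {u} \<Longrightarrow> w u v = 1"
  shows "utility w P u = ereal (real (card Y) - 1)"
proof -
  have "utility w P u = (\<Sum>v\<in>Y - {u}. ereal 1)"
    unfolding utility_def assms(1) by (rule sum.cong) (auto simp: assms(4) one_ereal_def)
  moreover have "0 < card Y"
    using assms card_gt_0_iff by blast
  ultimately show ?thesis
    using assms by (simp add: of_nat_diff)
qed

section \<open>Realizing size steps by deviations\<close>

text \<open>Multiplicities in \<open>mset_set P\<close> are at most 1, so the summands have disjoint
  supports, which serve as \<open>Q\<close> and \<open>R\<close>. This pulls a splitting of the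
  multiset of sizes back to the partition.\<close>

lemma mset_set_eq_plusE:
  assumes "finite P" "mset_set P = B + C"
  obtains Q R where "P = Q \<union> R" "Q \<inter> R = {}" "B = mset_set Q" "C = mset_set R"
proof
  have eq: "count B x + count C x = (if x \<in> P then 1 else 0)" for x
    using arg_cong[OF assms(2), of "\<lambda>M. count M x"] assms(1) by (simp add: count_mset_set')
  show "P = set_mset B \<union> set_mset C"
    using arg_cong[OF assms(2), of set_mset] assms(1) by simp
  show "set_mset B \<inter> set_mset C = {}"
  proof (rule ccontr)
    assume "set_mset B \<inter> set_mset C \<noteq> {}"
    then obtain x where "0 < count B x" "0 < count C x"
      by auto
    moreover have "count B x + count C x \<le> 1"
      using eq[of x] by simp
    ultimately show False
      by linarith
  qed
  show "B = mset_set (set_mset B)"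
  proof (rule multiset_eqI)
    fix x
    show "count B x = count (mset_set (set_mset B)) x"
      using eq[of x] by (auto simp: count_mset_set' not_in_iff simp flip: count_greater_zero_iff split: if_splits)
  qed
  show "C = mset_set (set_mset C)"
  proof (rule multiset_eqI)
    fix x
    show "count C x = count (mset_set (set_mset C)) x"
      using eq[of x] by (auto simp: count_mset_set' not_in_iff simp flip: count_greater_zero_iff split: if_splits)
  qed
qed

lemma filter_mset_replicate_mset:
  "filter_mset P (replicate_mset n x) = (if P x then replicate_mset n x else {#})"
  by (induction n) auto

text \<open>Remainders of disjoint sets can coincide only when empty, so \<open>Y - S\<close> is
  injective on those that survive; the discarded empty remainders correspond to the zeros filtered
  out.\<close>

lemma image_card_mset_set_diff:
  assumes "finite P" "disjoint P" "\<And>Y. Y \<in> P \<Longrightarrow> finite Y"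
  shows "image_mset card (mset_set ((\<lambda>Y. Y - S) ` P - {{}})) =
    filter_mset ((<) 0) (image_mset (\<lambda>Y. card (Y - S)) (mset_set P))"
proof -
  let ?Q = "{Y \<in> P. 0 < card (Y - S)}"
  have eq: "(\<lambda>Y. Y - S) ` P - {{}} = (\<lambda>Y. Y - S) ` ?Q"
    using assms(3) by (auto simp: card_gt_0_iff)
  have inj: "inj_on (\<lambda>Y. Y - S) ?Q"
  proof (rule inj_onI)
    fix Y Z
    assume *: "Y \<in> ?Q" "Z \<in> ?Q" "Y - S = Z - S"
    then have "Y \<inter> Z \<noteq> {}"
      by (auto simp: card_gt_0_iff)
    then show "Y = Z"
      using * assms(2) by (auto simp: disjoint_def)
  qed
  show ?thesis
    unfolding eq image_mset_mset_set[OF inj, symmetric] filter_mset_image_mset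
    using assms(1) by (simp add: image_mset.compositionality comp_def)
qed

text \<open>One player is taken from each of \<open>r\<close> groups of size \<open>p\<close>, and
  all move to a group of size \<open>q\<close>. With all weights 1 their utility rises from
  \<open>p - 1\<close> to \<open>q + r - 1\<close>. Filtering out zeros turns formal sizes into
  sizes of actual groups.\<close>

lemma size_step_realizable:
  assumes V: "finite V" and P: "partition_on V P"
    and M: "image_mset card (mset_set P) = filter_mset ((<) 0) M" and step: "size_step M N"
  shows "\<exists>P'. deviates V (\<lambda>_ _. 1) 3 P P' \<and> partition_on V P' \<and>
    image_mset card (mset_set P') = filter_mset ((<) 0) N"
  using step
proof cases
  case (size_stepI r p q A)
  have fP: "finite P"
    using V P by (rule finite_elements)
  have disj: "Y \<inter> Z = {}" if "Y \<in> P" "Z \<in> P" "Y \<noteq> Z" for Y Z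
    using partition_onD2[OF P] that by (auto simp: disjoint_def)
  have fin: "finite Y" if "Y \<in> P" for Y
    using that partition_onD1[OF P] V by (metis Sup_upper finite_subset)
  have "image_mset card (mset_set P) =
      filter_mset ((<) 0) A + replicate_mset r p + filter_mset ((<) 0) {#q#}"
    using size_stepI M by (simp add: filter_mset_replicate_mset)
  then obtain B B3 where B: "mset_set P = B + B3"
    and B': "filter_mset ((<) 0) A + replicate_mset r p = image_mset card B"
    and B3: "filter_mset ((<) 0) {#q#} = image_mset card B3"
    by (auto dest: image_mset_eq_plusD)
  from B' obtain B1 B2 where B12: "B = B1 + B2"
    and B1: "filter_mset ((<) 0) A = image_mset card B1" and B2: "replicate_mset r p = image_mset card B2"
    by (metis image_mset_eq_plusD)
  obtain T R3 where T: "P = T \<union> R3" "T \<inter> R3 = {}" "B = mset_set T" "B3 = mset_set R3"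
    using mset_set_eq_plusE[OF fP B] by blast
  then have "finite T" "finite R3"
    using fP by auto
  obtain R Q where RQ: "T = R \<union> Q" "R \<inter> Q = {}" "B1 = mset_set R" "B2 = mset_set Q"
    using mset_set_eq_plusE[OF \<open>finite T\<close> T(3)[symmetric, unfolded B12]] by blast
  then have "finite R" "finite Q"
    using \<open>finite T\<close> by auto
  have cardQ: "card Q = r"
    using arg_cong[OF B2, of size] RQ(4) by simp
  have cardY: "card Y = p" if "Y \<in> Q" for Y
  proof -
    have "card Y \<in># replicate_mset r p"
      unfolding B2 RQ(4) using that \<open>finite Q\<close> by simp
    then show ?thesis by (simp split: if_splits)
  qed
  \<comment> \<open>An entry \<open>q = 0\<close> has no counterpart in \<open>P\<close>; the target
    is then the empty group, and \<open>{X} - {{}}\<close> covers both cases.\<close>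
  obtain X where X: "R3 = {X} - {{}}" "card X = q" "finite X" "X \<in> P \<or> X = {}"
  proof (cases "q = 0")
    case True
    then have "R3 = {}"
      using B3 T(4) \<open>finite R3\<close> by (simp add: mset_set_empty_iff)
    then show ?thesis
      using that[of "{}"] True by simp
  next
    case False
    then have im: "image_mset card (mset_set R3) = {#q#}"
      using B3 T(4) by simp
    then have "card R3 = 1"
      by (metis size_image_mset size_mset_set size_single)
    then obtain X where "R3 = {X}"
      by (rule card_1_singletonE)
    then show ?thesis
      using that[of X] im T(1) fin False by (auto simp: card_gt_0_iff)
  qed
  have PX: "P - {X} = R \<union> Q"
    using T X RQ partition_onD3[OF P] by auto
  have XRQ: "X \<inter> Y = {}" if "Y \<in> R \<union> Q" for Y
    using that PX X(4) disj by blast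
  define pick where "pick Y = (SOME y. y \<in> Y)" for Y :: "'a set"
  define S where "S = pick ` Q"
  have pick: "pick Y \<in> Y" if "Y \<in> Q" for Y
    using cardY[OF that] \<open>0 < p\<close> unfolding pick_def
    by (metis all_not_in_conv card.empty less_irrefl someI_ex)
  have QP: "Q \<subseteq> P" "R \<subseteq> P"
    using PX by auto
  have "inj_on pick Q"
  proof (rule inj_onI)
    fix Y Z
    assume "Y \<in> Q" "Z \<in> Q" "pick Y = pick Z"
    then show "Y = Z"
      using disj[of Y Z] pick[of Y] pick[of Z] QP by auto
  qed
  then have cardS: "card S = r"
    unfolding S_def using cardQ by (simp add: card_image)
  have "S \<noteq> {}"
    using cardS \<open>0 < r\<close> by auto
  have "finite S"
    unfolding S_def using \<open>finite Q\<close> by simp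
  have SV: "S \<subseteq> V"
    using pick QP partition_onD1[OF P] unfolding S_def by blast
  have YS: "Y \<inter> S = {pick Y}" if "Y \<in> Q" for Y
    unfolding S_def using that pick disj QP by fastforce
  have RS: "Y \<inter> S = {}" if "Y \<in> R" for Y
    unfolding S_def using that pick disj QP RQ(2) by fastforce
  have XS: "X \<inter> S = {}"
    unfolding S_def using XRQ pick by blast
  have cardXS: "card (X \<union> S) = q + r"
    using X \<open>finite S\<close> XS cardS by (simp add: card_Un_disjoint)
  let ?P = "move P S X"
  have part: "partition_on V ?P"
    by (rule partition_on_move[OF P SV X(4)])
  have "is_deviation V (\<lambda>_ _. 1) 3 P S X"
    unfolding is_deviation_def
  proof (intro conjI ballI)
    show "card S \<le> 3"
      using cardS \<open>r \<le> 3\<close> by simp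
    fix u
    assume u: "u \<in> S"
    then obtain Y where Y: "Y \<in> Q" "u \<in> Y"
      unfolding S_def using pick by blast
    have "utility (\<lambda>_ _. 1) P u = ereal (real p - 1)"
      using utility_clique[OF group_of_eq[OF P _ Y(2)]] Y QP fin cardY by auto
    moreover have "utility (\<lambda>_ _. 1) ?P u = ereal (real (q + r) - 1)"
      using utility_clique[OF group_of_move[OF P SV X(4) u]] X(3) \<open>finite S\<close> u cardXS by auto
    ultimately show "utility (\<lambda>_ _. 1) P u < utility (\<lambda>_ _. 1) ?P u"
      using \<open>p < q + r\<close> by simp
  qed (use SV \<open>S \<noteq> {}\<close> X(4) in auto)
  then have dev: "deviates V (\<lambda>_ _. 1) 3 P ?P"
    unfolding deviates_def using P by blast
  have "?P = insert (X \<union> S) ((\<lambda>Y. Y - S) ` (R \<union> Q) - {{}})"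
    unfolding move_def PX using \<open>S \<noteq> {}\<close> by auto
  \<comment> \<open>The new group contains \<open>S\<close>, which every remainder avoids.\<close>
  moreover have "X \<union> S \<notin> (\<lambda>Y. Y - S) ` (R \<union> Q) - {{}}"
    using \<open>S \<noteq> {}\<close> by auto
  ultimately have "image_mset card (mset_set ?P) =
      {#q + r#} + image_mset card (mset_set ((\<lambda>Y. Y - S) ` (R \<union> Q) - {{}}))"
    using \<open>finite R\<close> \<open>finite Q\<close> cardXS by simp
  also have "image_mset card (mset_set ((\<lambda>Y. Y - S) ` (R \<union> Q) - {{}})) =
      filter_mset ((<) 0) (image_mset (\<lambda>Y. card (Y - S)) (mset_set (R \<union> Q)))"
  proof (rule image_card_mset_set_diff)
    show "disjoint (R \<union> Q)"
      using disj QP by (auto simp: disjoint_def)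
  qed (use \<open>finite R\<close> \<open>finite Q\<close> QP fin in auto)
  also have "mset_set (R \<union> Q) = mset_set R + mset_set Q"
    by (rule mset_set_Union) (use \<open>finite R\<close> \<open>finite Q\<close> RQ(2) in auto)
  also have "image_mset (\<lambda>Y. card (Y - S)) (mset_set R + mset_set Q) =
      image_mset card (mset_set R) + image_mset (\<lambda>Y. p - 1) (mset_set Q)"
  proof -
    have "image_mset (\<lambda>Y. card (Y - S)) (mset_set R) = image_mset card (mset_set R)"
      by (rule image_mset_cong) (use \<open>finite R\<close> RS in \<open>simp add: Diff_triv\<close>)
    moreover have "image_mset (\<lambda>Y. card (Y - S)) (mset_set Q) = image_mset (\<lambda>Y. p - 1) (mset_set Q)"
      by (rule image_mset_cong) (use \<open>finite Q\<close> YS cardY fin QP in \<open>auto simp: card_Diff_subset_Int\<close>)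
    ultimately show ?thesis by simp
  qed
  also have "\<dots> = filter_mset ((<) 0) A + replicate_mset r (p - 1)"
    using B1 RQ(3) cardQ by (simp add: image_mset_const_eq)
  \<comment> \<open>For \<open>p = 1\<close> the drained groups vanish, matching the zeros filtered
    out of \<open>N\<close>.\<close>
  finally have "image_mset card (mset_set ?P) = filter_mset ((<) 0) N"
    using size_stepI(2,4) by (simp add: filter_mset_replicate_mset filter_filter_mset)
  then show ?thesis
    using dev part by blast
qed

lemma size_steps_realizable:
  assumes V: "finite V" and "partition_on V P"
    and "image_mset card (mset_set P) = filter_mset ((<) 0) M" and "(size_step ^^ t) M N"
  shows "\<exists>P'. (deviates V (\<lambda>_ _. 1) 3 ^^ t) P P' \<and> partition_on V P' \<and>
    image_mset card (mset_set P') = filter_mset ((<) 0) N"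
  using assms(4)
proof (induction t arbitrary: N)
  case 0
  then show ?case using assms by auto
next
  case (Suc t)
  then obtain M' where M': "(size_step ^^ t) M M'" "size_step M' N"
    by auto
  then obtain P' where P': "(deviates V (\<lambda>_ _. 1) 3 ^^ t) P P'" "partition_on V P'"
      "image_mset card (mset_set P') = filter_mset ((<) 0) M'"
    using Suc.IH by blast
  show ?case
    using size_step_realizable[OF V P'(2,3) M'(2)] P'(1) by (meson relpowp_Suc_I)
qed

lemma deviation_length_staircase:
  fixes V :: "'a set"
  assumes "finite V" "card V = m * Suc m"
  shows "deviation_length V (\<lambda>_ _. 1) 3 (2 * (m + 2 choose 4))"
proof -
  obtain z where "(size_step ^^ (2 * (m + 2 choose 4))) ({#} + replicate_mset (m * Suc m) 1)
      ({#} + staircase m + replicate_mset z 0)"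
    using size_steps_staircase by blast
  moreover have "image_mset card (mset_set (singletons V)) =
      filter_mset ((<) 0) ({#} + replicate_mset (m * Suc m) 1)"
  proof -
    have "inj_on (\<lambda>u. {u}) V"
      by simp
    then show ?thesis
      unfolding singletons_def image_mset_mset_set[symmetric, OF \<open>inj_on (\<lambda>u. {u}) V\<close>]
      using assms by (simp add: image_mset.compositionality comp_def image_mset_const_eq
          filter_mset_replicate_mset)
  qed
  moreover have "partition_on V (singletons V)"
    unfolding singletons_def by (rule partition_on_singletons)
  ultimately show ?thesis
    unfolding deviation_length_def using size_steps_realizable assms(1) by blast
qed

section \<open>Boundedness of deviation sequences\<close>

lemma card_partition_on_le:
  assumes "finite V" "partition_on V P"
  shows "card P \<le> card V"
proof -
  have "finite P"
    using assms by (rule finite_elements)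
  have "1 \<le> card Y" if "Y \<in> P" for Y
    using that assms partition_onD1 partition_onD3
    by (metis Sup_upper card_0_eq finite_subset less_one not_le)
  then have "(\<Sum>Y\<in>P. 1) \<le> (\<Sum>Y\<in>P. card Y)"
    by (rule sum_mono)
  then show ?thesis
    using product_partition[OF assms(2)] assms partition_onD1[OF assms(2)]
    by (metis Sup_upper card_eq_sum finite_subset)
qed

text \<open>Invariant of the states reachable from the singletons in a uniform game; it makes every
  utility the group size minus 1.\<close>

definition friendly :: "('a \<Rightarrow> 'a \<Rightarrow> ereal) \<Rightarrow> 'a set set \<Rightarrow> bool" where
  "friendly w P \<longleftrightarrow> (\<forall>Y\<in>P. \<forall>u\<in>Y. \<forall>v\<in>Y. u \<noteq> v \<longrightarrow> w u v = 1)"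

text \<open>With \<open>n\<close> players there are at most \<open>n\<close> groups, so one group of size \<open>t\<close> outweighs
  all the smaller groups that it draws from.\<close>
definition size_potential :: "nat \<Rightarrow> 'a set set \<Rightarrow> nat" where
  "size_potential n P = (\<Sum>Y\<in>P. Suc n ^ card Y)"

text \<open>A strict gain forces a final utility above \<open>- \<infinity>\<close>, so movers have
  weight 1 to their whole new group and friendliness persists. Utilities then count group members,
  so movers come from groups smaller than the new one, whose term outweighs all terms lost.\<close>

lemma deviation_increases:
  assumes game: "uniform_game V w" and dev: "deviates V w k P P'" and fr: "friendly w P"
  shows "partition_on V P' \<and> friendly w P' \<and>
    size_potential (card V) P < size_potential (card V) P'"
proof -
  have V: "finite V"
    and sym: "\<And>u v. u \<in> V \<Longrightarrow> v \<in> V \<Longrightarrow> u \<noteq> v \<Longrightarrow> w u v = w v u"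
    and weights: "\<And>u v. u \<in> V \<Longrightarrow> v \<in> V \<Longrightarrow> u \<noteq> v \<Longrightarrow> w u v \<in> {- \<infinity>, 1}"
    using game by (auto simp: uniform_game_def coloring_game_def)
  obtain S X where P: "partition_on V P" and "is_deviation V w k P S X" and P': "P' = move P S X"
    using dev by (auto simp: deviates_def)
  then have S: "S \<subseteq> V" "S \<noteq> {}" and X: "X \<in> P \<or> X = {}"
    and gain: "\<And>u. u \<in> S \<Longrightarrow> utility w P u < utility w P' u"
    by (auto simp: is_deviation_def)
  have part: "partition_on V P'"
    unfolding P' by (rule partition_on_move[OF P S(1) X])
  have fin: "finite Y" "Y \<subseteq> V" if "Y \<in> P" for Y
    using that partition_onD1[OF P] V by (metis Sup_upper finite_subset, blast)
  have XS: "X \<union> S \<subseteq> V" "finite (X \<union> S)"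
    using X S V fin by (auto intro: finite_subset)
  have w1: "w u v = 1" if u: "u \<in> S" and v: "v \<in> X \<union> S" and "u \<noteq> v" for u v
  proof (rule ccontr)
    assume "w u v \<noteq> 1"
    then have "w u v = - \<infinity>"
      using weights[of u v] u v \<open>u \<noteq> v\<close> XS(1) by auto
    \<comment> \<open>A single weight \<open>- \<infinity>\<close> makes the sum infinite; the bound
      by a finite sum of ones excludes \<open>\<infinity>\<close>.\<close>
    then have "\<bar>\<Sum>v\<in>X \<union> S - {u}. w u v\<bar> = \<infinity>"
      unfolding sum_Inf using v \<open>u \<noteq> v\<close> XS(2) by (auto intro!: bexI[of _ v])
    moreover have "(\<Sum>v\<in>X \<union> S - {u}. w u v) \<le> (\<Sum>v\<in>X \<union> S - {u}. ereal 1)"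
      by (rule sum_mono) (use weights[of u] u XS(1) in \<open>force simp: one_ereal_def\<close>)
    ultimately have "(\<Sum>v\<in>X \<union> S - {u}. w u v) = - \<infinity>"
      by auto
    then have "utility w P' u = - \<infinity>"
      using group_of_move[OF P S(1) X u] by (simp add: utility_def P')
    then show False
      using gain[OF u] by simp
  qed
  have "friendly w P'"
    unfolding friendly_def
  proof (intro ballI impI)
    fix Y u v
    assume Y: "Y \<in> P'" "u \<in> Y" "v \<in> Y" "u \<noteq> v"
    show "w u v = 1"
    proof (cases "Y = X \<union> S")
      case True
      show ?thesis
      proof (cases "u \<in> S \<or> v \<in> S")
        case True
        have "w u v = w v u"
          using sym Y(2-4) \<open>Y = X \<union> S\<close> XS(1) by blast
        then show ?thesis
          using w1 True Y(2-4) \<open>Y = X \<union> S\<close> by metis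
      next
        case False
        then show ?thesis
          using Y True X fr unfolding friendly_def by blast
      qed
    next
      case False
      then obtain W where "W \<in> P" "Y = W - S"
        using Y(1) unfolding P' move_def by blast
      then show ?thesis
        using Y fr unfolding friendly_def by blast
    qed
  qed
  have less: "card Y < card (X \<union> S)" if Y: "Y \<in> P" "u \<in> Y" "u \<in> S" for Y u
  proof -
    have "utility w P u = ereal (real (card Y) - 1)"
      by (rule utility_clique[OF group_of_eq[OF P Y(1,2)] fin(1)[OF Y(1)] Y(2)])
        (use fr Y in \<open>auto simp: friendly_def\<close>)
    moreover have "utility w P' u = ereal (real (card (X \<union> S)) - 1)"
      unfolding P' by (rule utility_clique[OF group_of_move[OF P S(1) X Y(3)] XS(2)])
        (use w1 Y in auto)
    ultimately show ?thesis
      using gain[OF Y(3)] by simp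
  qed
  define N where "N = Suc (card V)"
  define t where "t = card (X \<union> S)"
  \<comment> \<open>\<open>U\<close> collects the groups that the move leaves untouched.\<close>
  define U where "U = {Y \<in> P. Y \<noteq> X \<and> Y \<inter> S = {}}"
  have "finite P"
    using V P by (rule finite_elements)
  have "finite P'"
    using V part by (rule finite_elements)
  \<comment> \<open>A group outside \<open>U\<close> that avoids \<open>S\<close> must be
    \<open>X\<close>, a proper part of the new group; any other one contains a member of
    \<open>S\<close>, who gains strictly.\<close>
  have small: "card Y < t" if "Y \<in> P - U" for Y
  proof (cases "Y \<inter> S = {}")
    case True
    then have "Y = X"
      using that by (auto simp: U_def)
    then have "Y \<subset> X \<union> S"
      using True S(2) by auto
    then show ?thesis
      unfolding t_def using XS(2) by (rule psubset_card_mono[rotated])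
  next
    case False
    then show ?thesis
      using less that unfolding t_def by blast
  qed
  have "t \<noteq> 0"
    using XS(2) S(2) by (simp add: t_def)
  have "(\<Sum>Y\<in>P - U. N ^ card Y) \<le> (\<Sum>Y\<in>P - U. N ^ (t - 1))"
  proof (rule sum_mono)
    fix Y
    assume "Y \<in> P - U"
    then show "N ^ card Y \<le> N ^ (t - 1)"
      using small[of Y] by (intro power_increasing) (auto simp: N_def)
  qed
  also have "\<dots> = card (P - U) * N ^ (t - 1)"
    by simp
  also have "\<dots> \<le> card V * N ^ (t - 1)"
    using card_partition_on_le[OF V P] card_mono[OF \<open>finite P\<close>, of "P - U"] by simp
  also have "\<dots> < N * N ^ (t - 1)"
    by (simp add: N_def)
  also have "\<dots> = N ^ t"
    using \<open>t \<noteq> 0\<close> by (simp add: power_eq_if)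
  finally have lost: "(\<Sum>Y\<in>P - U. N ^ card Y) < N ^ t" .
  have "finite U"
    using \<open>finite P\<close> by (simp add: U_def)
  have "(\<Sum>Y\<in>P. N ^ card Y) = (\<Sum>Y\<in>P - U. N ^ card Y) + (\<Sum>Y\<in>U. N ^ card Y)"
    by (rule sum.subset_diff) (use \<open>finite P\<close> in \<open>auto simp: U_def\<close>)
  also have "\<dots> < N ^ t + (\<Sum>Y\<in>U. N ^ card Y)"
    using lost by simp
  also have "\<dots> = (\<Sum>Y\<in>insert (X \<union> S) U. N ^ card Y)"
  proof -
    have "X \<union> S \<notin> U"
      using S(2) by (auto simp: U_def)
    then show ?thesis
      using \<open>finite U\<close> by (simp add: t_def)
  qed
  also have "\<dots> \<le> (\<Sum>Y\<in>P'. N ^ card Y)"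
  proof (rule sum_mono2[OF \<open>finite P'\<close>])
    have "Y \<in> P'" if "Y \<in> U" for Y
    proof -
      have "Y = Y - S" "Y \<in> P - {X}" "Y \<noteq> {}"
        using that partition_onD3[OF P] by (auto simp: U_def)
      then show ?thesis
        unfolding P' move_def by blast
    qed
    then show "insert (X \<union> S) U \<subseteq> P'"
      using S(2) by (auto simp: P' move_def)
  qed simp
  finally show ?thesis
    using part \<open>friendly w P'\<close> by (simp add: size_potential_def N_def)
qed

text \<open>The potential grows by at least 1 per deviation, while at most \<open>card V\<close>
  groups contribute at most \<open>Suc (card V) ^ card V\<close> each.\<close>

lemma deviation_length_bound:
  assumes game: "uniform_game V w" and len: "deviation_length V w k m"
  shows "m \<le> card V * Suc (card V) ^ card V"
proof -
  have V: "finite V"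
    using game by (simp add: uniform_game_def coloring_game_def)
  have steps: "partition_on V P \<and> friendly w P \<and> m \<le> size_potential (card V) P"
    if "(deviates V w k ^^ m) (singletons V) P" for P
    using that
  proof (induction m arbitrary: P)
    case 0
    then show ?case
      using partition_on_singletons[of V] by (auto simp: singletons_def friendly_def)
  next
    case (Suc m)
    then obtain Q where "(deviates V w k ^^ m) (singletons V) Q" "deviates V w k Q P"
      by auto
    then show ?case
      using Suc.IH[of Q] deviation_increases[OF game, of k Q P] by auto
  qed
  obtain P where P: "partition_on V P" "m \<le> size_potential (card V) P"
    using len steps by (auto simp: deviation_length_def)
  have "size_potential (card V) P \<le> (\<Sum>Y\<in>P. Suc (card V) ^ card V)"
    unfolding size_potential_def
  proof (intro sum_mono power_increasing card_mono V)
    fix Y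
    assume "Y \<in> P"
    then show "Y \<subseteq> V"
      using partition_onD1[OF P(1)] by auto
  qed simp
  also have "\<dots> \<le> card V * Suc (card V) ^ card V"
    using card_partition_on_le[OF V P(1)] by simp
  finally show ?thesis
    using P(2) by simp
qed

section \<open>Quadratic growth of \<open>L 3 n\<close>\<close>

text \<open>For \<open>Max\<close> to dominate its members the set of lengths must be finite. The
  bound on lengths increases with \<open>card V\<close>, hence is uniform over all games with at
  most \<open>n\<close> players.\<close>

lemma L_ge:
  fixes V :: "nat set"
  assumes "uniform_game V w" "card V \<le> n" "deviation_length V w k m"
  shows "m \<le> L k n"
  unfolding L_def
proof (rule Max_ge)
  let ?B = "{m. \<exists>(V :: nat set) w. uniform_game V w \<and> card V \<le> n \<and> deviation_length V w k m}"
  have "m \<le> n * Suc n ^ n" if m: "m \<in> ?B" for m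
  proof -
    obtain V :: "nat set" and w where V: "uniform_game V w" "card V \<le> n" "deviation_length V w k m"
      using m by blast
    have "m \<le> card V * Suc (card V) ^ card V"
      using V(1,3) by (rule deviation_length_bound)
    also have "\<dots> \<le> n * Suc n ^ n"
    proof (rule mult_mono)
      have "Suc (card V) ^ card V \<le> Suc n ^ card V"
        using V(2) by (intro power_mono) auto
      also have "\<dots> \<le> Suc n ^ n"
        using V(2) by (intro power_increasing) auto
      finally show "Suc (card V) ^ card V \<le> Suc n ^ n" .
    qed (use V(2) in auto)
    finally show ?thesis .
  qed
  then have "?B \<subseteq> {..n * Suc n ^ n}"
    by blast
  then show "finite ?B"
    by (rule finite_subset) simp
  show "m \<in> ?B"
    using assms by blast
qed

theorem theorem3: "(\<lambda>n. real (L 3 n)) \<in> \<Omega>(\<lambda>n. real n ^ 2)"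
proof (rule landau_omega.bigI)
  \<comment> \<open>The constant comes from
    \<open>2 * ((m + 2) / 4) ^ 4 = (m + 2) ^ 4 / 128\<close>, with \<open>m\<close> chosen
    below.\<close>
  show "eventually (\<lambda>n. norm (real (L 3 n)) \<ge> 1 / 128 * norm (real n ^ 2)) sequentially"
  \<comment> \<open>From 9 on, \<open>m\<close> is at least 2, so that \<open>4 \<le> m + 2\<close>
    holds for the binomial estimate.\<close>
  proof (rule eventually_mono[OF eventually_ge_at_top[of 9]])
    fix n :: nat
    assume "9 \<le> n"
    \<comment> \<open>With \<open>m + 1\<close> the integer square root of \<open>n\<close>, the
      \<open>m * (m + 1)\<close> players of the staircase fit into \<open>n\<close>, while
      \<open>n < (m + 2) ^ 2\<close>.\<close>
    define m where "m = floor_sqrt n - 1"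
    have "floor_sqrt 9 \<le> floor_sqrt n"
      using \<open>9 \<le> n\<close> by (rule mono_floor_sqrt')
    moreover have "floor_sqrt 9 = 3"
      using floor_sqrt_inverse_power2[of 3] by simp
    ultimately have m: "2 \<le> m" "floor_sqrt n = Suc m"
      by (auto simp: m_def)
    have "m * Suc m \<le> Suc m * Suc m"
      by simp
    also have "\<dots> \<le> n"
      using floor_sqrt_power2_le[of n] m(2) by (simp add: power2_eq_square)
    finally have "card {..<m * Suc m} \<le> n"
      by simp
    moreover have "uniform_game {..<m * Suc m} (\<lambda>_ _. 1)"
      unfolding uniform_game_def coloring_game_def one_ereal_def by (auto intro!: image_eqI[of _ _ 1])
    moreover have "deviation_length {..<m * Suc m} (\<lambda>_ _. 1) 3 (2 * (m + 2 choose 4))"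
      by (rule deviation_length_staircase) auto
    ultimately have L: "2 * (m + 2 choose 4) \<le> L 3 n"
      by (intro L_ge)
    have "n \<le> (m + 2) ^ 2"
      using Suc_floor_sqrt_power2_gt[of n] m(2) by simp
    then have "real n \<le> real ((m + 2) ^ 2)"
      by (simp only: of_nat_le_iff)
    then have "real n ^ 2 \<le> (real (m + 2) ^ 2) ^ 2"
      by (intro power_mono) simp_all
    also have "\<dots> = 256 * (real (m + 2) / real 4) ^ 4"
      by (simp add: power_divide flip: power_mult)
    also have "\<dots> \<le> 256 * real (m + 2 choose 4)"
      using binomial_ge_n_over_k_pow_k[of 4 "m + 2", where 'a = real] m(1) by simp
    finally have "real n ^ 2 \<le> 128 * real (L 3 n)"
      using L by linarith
    then show "norm (real (L 3 n)) \<ge> 1 / 128 * norm (real n ^ 2)"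
      by simp
  qed
qed simp

end
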